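(* Let $r\ge 35$ and $t\ge 1$ be integers and set $\gamma=\gamma(r)=\frac{1}{8r2^r}$. Then there exists an infinite class $\mathcal{H}_{r,t}$ of graphs such that every $H\in\mathcal{H}_{r,t}$ satisfies all of the following: $H$ has a separator set of size at most $\gamma |H|$; $H$ has bandwidth at least $\frac{0.3\,|H|}{2t+4}$; and $\Delta(H)=O(1/\gamma)$, where the constant implied by $O(\cdot)$ is absolute.
   Context: All graphs are finite and simple. $|H|$ denotes the number of vertices of $H$ and $\Delta(H)$ its maximum degree. The bandwidth $bw(H)$ of an $n$-vertex graph $H$ is the smallest positive integer $b$ such that there is a labelling of the vertices of $H$ by the numbers $1,\ldots,n$ (a bijection) for which the labels of every pair of adjacent vertices differ by at most $b$. An $n$-vertex graph $H$ is called $\gamma$-separable if there is a separator set $S\subset V(H)$ with $|S|\le \gamma n$ such that every component of $H-S$ has at most $\gamma n$ vertices; "separator set of size at most $\gamma|H|$" is meant in this sense. *)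

theory Defs
  imports Complex_Main "Graph_Theory.Graph_Theory"
begin

text \<open>
  A finite simple graph is a \<^locale>\<open>pair_graph\<close>: a finite vertex set together with a
  symmetric, irreflexive edge relation on it, so each edge is present as two opposite arcs.
\<close>

definition order_of :: "'a pair_pre_digraph \<Rightarrow> nat" where
  "order_of H = card (pverts H)"

text \<open>By symmetry of the edge relation, the out-degree is the degree. The null graph gets 0.\<close>

definition max_degree :: "'a pair_pre_digraph \<Rightarrow> nat" where
  "max_degree H = Max (insert 0 (out_degree (with_proj H) ` pverts H))"

definition bandwidth :: "'a pair_pre_digraph \<Rightarrow> nat" where
  "bandwidth H = (LEAST b. 0 < b \<and>
     (\<exists>f. bij_betw f (pverts H) {1..order_of H} \<and>
       (\<forall>(u, v) \<in> parcs H. \<bar>int (f u) - int (f v)\<bar> \<le> int b)))"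

text \<open>
  On a symmetric digraph the strongly connected components are the connected components;
  \<^const>\<open>pre_digraph.sccs_verts\<close> yields their vertex sets.
\<close>

definition separable :: "real \<Rightarrow> 'a pair_pre_digraph \<Rightarrow> bool" where
  "separable \<gamma> H \<longleftrightarrow>
     (\<exists>S \<subseteq> pverts H. real (card S) \<le> \<gamma> * real (order_of H) \<and>
       (\<forall>C \<in> pre_digraph.sccs_verts (induce_subgraph (with_proj H) (pverts H - S)).
          real (card C) \<le> \<gamma> * real (order_of H)))"

text \<open>
  A set of graphs on the natural numbers represents a class of graphs up to isomorphism. It could
  be infinite merely by containing relabelled copies of one graph, hence its members are required
  to be pairwise non-isomorphic.
\<close>

definition infinite_graph_class :: "nat pair_pre_digraph set \<Rightarrow> bool" where
  "infinite_graph_class \<H> \<longleftrightarrow> infinite \<H> \<and> (\<forall>H \<in> \<H>. pair_graph H) \<and>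
     (\<forall>H \<in> \<H>. \<forall>H' \<in> \<H>. digraph_iso (with_proj H) (with_proj H') \<longrightarrow> H = H')"

end

theory Submission
  imports Defs "HOL-Library.FuncSet"
begin

text \<open>
  Put \<open>p = s r 2\<^sup>r\<close>. The graphs are bipartite, with a small side \<open>S\<close> of \<open>s\<close> vertices and a large
  side \<open>T\<close>, and have \<open>8 p = s / \<gamma>\<close> vertices in total. Removing \<open>S\<close> leaves no edges, so \<open>S\<close> is a
  separator for free. The work lies in choosing the edges such that the degrees are bounded and the
  bandwidth is linear.

  Linear bandwidth comes from distances (\<open>bandwidth_greater_if_common_neighbours\<close>). If every two
  sets of \<open>3 p\<close> vertices contain two vertices with a common neighbour, then the \<open>3 p\<close> smallest and
  the \<open>3 p\<close> largest labels are joined by a path of length two; it must bridge the \<open>2 p\<close> labels in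
  between, so one of its edges stretches over more than \<open>p\<close> labels. Paths of length two are the right
  tool here: a direct cut argument would fail, because all of \<open>S\<close> fits into the middle of a labelling.

  The edges come from a counting argument (\<open>exists_function_with_large_images\<close>). Let every vertex
  of \<open>T\<close> pick ten elements of \<open>S\<close> at random. Any fixed \<open>2 p\<close> vertices of \<open>T\<close> make \<open>20 p\<close> picks, and
  these stay inside a fixed set of at most three quarters of \<open>S\<close> with probability at most
  \<open>(3/4)\<^bsup>20p\<^esup>\<close>. There are at most \<open>2\<^bsup>8p\<^esup>\<close> such pairs of sets, and \<open>2\<^sup>8 \<cdot> 3\<^sup>2\<^sup>0 < 4\<^sup>2\<^sup>0\<close>, so some choice
  lets every \<open>2 p\<close> vertices of \<open>T\<close> see more than three quarters of \<open>S\<close>. On average an element of \<open>S\<close>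
  is picked at most \<open>80 p / s\<close> times, so at most half of \<open>S\<close> is picked more than \<open>160 p / s = 20 / \<gamma>\<close>
  times. Deleting all edges at these elements bounds the degrees, and in the remaining part of \<open>S\<close>
  any two of the neighbourhoods still are too large to be disjoint
  (\<open>exists_bounded_degree_mixing_relation\<close>).
\<close>

section \<open>A random function has large images\<close>

text \<open>
  Union bound over the pairs of a set \<open>A\<close> in the family and a set \<open>U\<close> that is too small to be
  permitted as a superset of the image of \<open>A\<close>. The factor \<open>2 ^ card S\<close> counts the choices of \<open>U\<close>, and
  a random function maps \<open>A\<close> into \<open>U\<close> with probability at most \<open>(3/4) ^ k\<close>.
\<close>

lemma exists_function_with_large_images:
  fixes I :: "'i set" and S :: "'s set" and \<A> :: "'i set set"
  assumes "finite I" "finite S" "S \<noteq> {}"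
    and \<A>: "\<And>A. A \<in> \<A> \<Longrightarrow> A \<subseteq> I \<and> card A = k"
    and few: "card \<A> * 2 ^ card S * 3 ^ k < (4::nat) ^ k"
  shows "\<exists>g \<in> I \<rightarrow> S. \<forall>A \<in> \<A>. 3 * card S < 4 * card (g ` A)"
proof -
  define \<U> where "\<U> = {U \<in> Pow S. 4 * card U \<le> 3 * card S}"
  define F where "F = PiE I (\<lambda>_. S)"
  define bad where "bad = (\<lambda>(A, U). PiE I (\<lambda>i. if i \<in> A then U else S))"
  have finite_\<A>: "finite \<A>"
    using \<A> \<open>finite I\<close> by (auto intro: finite_subset[of _ "Pow I"])
  have finite_\<U>: "finite \<U>" and card_\<U>: "card \<U> \<le> 2 ^ card S"
    using \<open>finite S\<close> card_mono[of "Pow S" \<U>] by (auto simp: \<U>_def card_Pow)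
  have card_F: "card F = card S ^ card I"
    using \<open>finite I\<close> by (simp add: F_def card_PiE)
  have card_bad: "4 ^ k * card (bad q) \<le> 3 ^ k * card F" if q_in: "q \<in> \<A> \<times> \<U>" for q
  proof -
    obtain A U where q: "q = (A, U)" and "A \<in> \<A>" "U \<in> \<U>"
      using q_in by auto
    then have A: "A \<subseteq> I" "card A = k" and U: "4 * card U \<le> 3 * card S"
      using \<A> by (auto simp: \<U>_def)
    have split: "(\<Prod>i\<in>I. h i) = (\<Prod>i\<in>A. h i) * (\<Prod>i\<in>I - A. h i)" for h :: "'i \<Rightarrow> nat"
      using prod.subset_diff[OF A(1) \<open>finite I\<close>] by (simp add: mult.commute)
    have "card (bad q) = (\<Prod>i\<in>I. card (if i \<in> A then U else S))"
      using \<open>finite I\<close> by (simp add: q bad_def card_PiE)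
    also have "\<dots> = card U ^ k * card S ^ card (I - A)"
      by (simp add: split A(2))
    finally have "4 ^ k * card (bad q) = (4 * card U) ^ k * card S ^ card (I - A)"
      by (simp add: power_mult_distrib)
    also have "\<dots> \<le> (3 * card S) ^ k * card S ^ card (I - A)"
      using U by (intro mult_right_mono power_mono) auto
    also have "\<dots> = 3 ^ k * card F"
      using split[of "\<lambda>_. card S"] A(2) by (simp add: card_F power_mult_distrib)
    finally show ?thesis .
  qed
  have "0 < card F"
    using \<open>finite S\<close> \<open>S \<noteq> {}\<close> by (simp add: card_F card_gt_0_iff)
  have "4 ^ k * card (\<Union>q\<in>\<A> \<times> \<U>. bad q) \<le> 4 ^ k * (\<Sum>q\<in>\<A> \<times> \<U>. card (bad q))"
    using finite_\<A> finite_\<U> by (intro mult_left_mono card_UN_le) auto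
  also have "\<dots> \<le> (\<Sum>q\<in>\<A> \<times> \<U>. 3 ^ k * card F)"
    unfolding sum_distrib_left using card_bad by (rule sum_mono)
  also have "\<dots> = card \<A> * card \<U> * 3 ^ k * card F"
    by (simp add: card_cartesian_product)
  also have "\<dots> \<le> card \<A> * 2 ^ card S * 3 ^ k * card F"
    using card_\<U> by (intro mult_right_mono mult_left_mono) auto
  also have "\<dots> < 4 ^ k * card F"
    using few \<open>0 < card F\<close> by simp
  finally have "card (\<Union>q\<in>\<A> \<times> \<U>. bad q) < card F"
    by simp
  moreover have "finite (\<Union>q\<in>\<A> \<times> \<U>. bad q)"
    using finite_\<A> finite_\<U> \<open>finite I\<close> \<open>finite S\<close>
    by (auto simp: bad_def \<U>_def intro!: finite_PiE dest: finite_subset)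
  ultimately obtain g where "g \<in> F" and good: "g \<notin> (\<Union>q\<in>\<A> \<times> \<U>. bad q)"
    by (meson card_mono leD subsetI)
  have "3 * card S < 4 * card (g ` A)" if "A \<in> \<A>" for A
  proof (rule ccontr)
    assume "\<not> ?thesis"
    then have "g ` A \<in> \<U>"
      using \<A>[OF that] \<open>g \<in> F\<close> by (auto simp: \<U>_def F_def)
    moreover have "g \<in> bad (A, g ` A)"
      using \<open>g \<in> F\<close> by (auto simp: bad_def F_def PiE_iff)
    ultimately show False
      using good that by blast
  qed
  moreover have "g \<in> I \<rightarrow> S"
    using \<open>g \<in> F\<close> by (auto simp: F_def)
  ultimately show ?thesis
    by blast
qed

section \<open>A bipartite relation of bounded degree in which large sets meet\<close>

text \<open>
  Expansion into more than three quarters of \<open>S\<close> leaves room for trimming. If at most half of \<open>S\<close>, say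
  \<open>h\<close> elements, is overloaded and discarded, two neighbourhoods retain more than
  \<open>2 (3/4 card S - h) \<ge> card S - h\<close> elements in total, and so they meet in what is left of \<open>S\<close>.
\<close>

lemma exists_bounded_degree_mixing_relation:
  fixes S :: "'s set" and T :: "'t set"
  assumes "finite S" "finite T" "S \<noteq> {}" "0 < p"
    and size: "card S + card T = 8 * p"
    and D: "160 * p \<le> D * card S"
  shows "\<exists>R \<subseteq> S \<times> T.
    (\<forall>x. card {y. (x, y) \<in> R} \<le> D) \<and> (\<forall>y. card {x. (x, y) \<in> R} \<le> 10) \<and>
    (\<forall>A \<subseteq> T. \<forall>B \<subseteq> T. card A = 2 * p \<longrightarrow> card B = 2 * p \<longrightarrow>
      (\<exists>x. \<exists>a \<in> A. \<exists>b \<in> B. (x, a) \<in> R \<and> (x, b) \<in> R))"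
proof -
  define I where "I = T \<times> {..<10::nat}"
  define \<A> where "\<A> = (\<lambda>A. A \<times> {..<10::nat}) ` {A \<in> Pow T. card A = 2 * p}"
  have "finite I" and card_I: "card I \<le> 80 * p"
    using \<open>finite T\<close> size by (auto simp: I_def card_cartesian_product)
  have "card \<A> \<le> card {A \<in> Pow T. card A = 2 * p}"
    using \<open>finite T\<close> by (auto simp: \<A>_def intro: card_image_le)
  also have "\<dots> \<le> 2 ^ card T"
    using card_mono[of "Pow T" "{A \<in> Pow T. card A = 2 * p}"] \<open>finite T\<close> by (auto simp: card_Pow)
  finally have "card \<A> * 2 ^ card S * 3 ^ (20 * p) \<le> 2 ^ card T * 2 ^ card S * 3 ^ (20 * p)"
    by (intro mult_right_mono) auto
  also have "\<dots> = (2 ^ 8 * 3 ^ 20) ^ p"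
    using size by (simp add: power_add[symmetric] power_mult power_mult_distrib add.commute
      del: power_numeral)
  also have "\<dots> < (4 ^ 20) ^ p"
    using \<open>0 < p\<close> by (intro power_strict_mono) auto
  finally have few: "card \<A> * 2 ^ card S * 3 ^ (20 * p) < (4::nat) ^ (20 * p)"
    by (simp only: power_mult)
  have "A \<subseteq> I \<and> card A = 20 * p" if "A \<in> \<A>" for A
    using that by (auto simp: \<A>_def I_def card_cartesian_product)
  from exists_function_with_large_images[OF \<open>finite I\<close> \<open>finite S\<close> \<open>S \<noteq> {}\<close> this few]
  obtain g where g: "g \<in> I \<rightarrow> S"
    and g_large: "\<And>A. A \<in> \<A> \<Longrightarrow> 3 * card S < 4 * card (g ` A)"
    by blast

  define picks where "picks x = {z \<in> I. g z = x}" for x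
  define High where "High = {x \<in> S. D < card (picks x)}"
  have "High \<subseteq> S" "finite High"
    using \<open>finite S\<close> by (auto simp: High_def)
  have "0 < D"
    using D \<open>0 < p\<close> by (cases D) auto
  have "D * card High = (\<Sum>x\<in>High. D)"
    by simp
  also have "\<dots> \<le> (\<Sum>x\<in>High. card (picks x))"
    by (rule sum_mono) (simp add: High_def)
  also have "\<dots> = card (\<Union>x\<in>High. picks x)"
    using \<open>finite High\<close> \<open>finite I\<close> by (subst card_UN_disjoint) (auto simp: picks_def)
  also have "\<dots> \<le> card I"
    using \<open>finite I\<close> by (intro card_mono) (auto simp: picks_def)
  finally have "D * card High \<le> 80 * p"
    using card_I by linarith
  then have "D * (2 * card High) \<le> D * card S"
    using D by linarith
  then have High_half: "2 * card High \<le> card S"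
    using \<open>0 < D\<close> by simp

  define R where "R = {(x, y). x \<in> S - High \<and> y \<in> T \<and> (\<exists>i<10. g (y, i) = x)}"
  have "card {y. (x, y) \<in> R} \<le> D" for x
  proof (cases "x \<in> S - High")
    case True
    have "{y. (x, y) \<in> R} \<subseteq> fst ` picks x"
      by (force simp: R_def picks_def I_def)
    then have "card {y. (x, y) \<in> R} \<le> card (picks x)"
      using \<open>finite I\<close> by (intro surj_card_le) (auto simp: picks_def)
    then show ?thesis
      using True by (auto simp: High_def)
  qed (auto simp: R_def)
  moreover have "card {x. (x, y) \<in> R} \<le> 10" for y
  proof -
    have "{x. (x, y) \<in> R} \<subseteq> (\<lambda>i. g (y, i)) ` {..<10}"
      by (auto simp: R_def)
    then show ?thesis
      using surj_card_le[of "{..<10::nat}"] by auto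
  qed
  moreover have "\<exists>x. \<exists>a \<in> A. \<exists>b \<in> B. (x, a) \<in> R \<and> (x, b) \<in> R"
    if A: "A \<subseteq> T" "card A = 2 * p" and B: "B \<subseteq> T" "card B = 2 * p" for A B
  proof -
    define N where "N X = g ` (X \<times> {..<10::nat}) - High" for X
    have N: "N X \<subseteq> S - High" "3 * card S < 4 * (card (N X) + card High)"
      if "X \<subseteq> T" "card X = 2 * p" for X
    proof -
      show "N X \<subseteq> S - High"
        using g that by (force simp: N_def I_def)
      have "3 * card S < 4 * card (g ` (X \<times> {..<10::nat}))"
        using that by (intro g_large) (auto simp: \<A>_def)
      moreover have "card (g ` (X \<times> {..<10::nat})) \<le> card (N X) + card High"
        using diff_card_le_card_Diff[OF \<open>finite High\<close>, of "g ` (X \<times> {..<10::nat})"]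
        by (simp add: N_def)
      ultimately show "3 * card S < 4 * (card (N X) + card High)"
        by simp
    qed
    have "N A \<inter> N B \<noteq> {}"
    proof
      assume disjoint: "N A \<inter> N B = {}"
      have "finite (N A)" "finite (N B)"
        using N(1)[OF A] N(1)[OF B] \<open>finite S\<close> by (auto dest: finite_subset)
      then have "card (N A) + card (N B) = card (N A \<union> N B)"
        using disjoint by (simp add: card_Un_disjoint)
      also have "\<dots> \<le> card (S - High)"
        using N(1)[OF A] N(1)[OF B] \<open>finite S\<close> by (intro card_mono) auto
      finally have "card (N A) + card (N B) + card High \<le> card S"
        using \<open>High \<subseteq> S\<close> \<open>finite High\<close> High_half by (simp add: card_Diff_subset)
      then show False
        using N(2)[OF A] N(2)[OF B] High_half by simp
    qed
    then obtain x where "x \<in> N A" "x \<in> N B"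
      by blast
    moreover have sees: "\<exists>a \<in> X. (x, a) \<in> R" if "X \<subseteq> T" "card X = 2 * p" "x \<in> N X" for X
      using that N(1)[OF that(1,2)] by (force simp: R_def N_def)
    ultimately have "\<exists>a \<in> A. (x, a) \<in> R" "\<exists>b \<in> B. (x, b) \<in> R"
      by (simp_all add: sees[OF A] sees[OF B])
    then show ?thesis
      by (intro exI[of _ x]) simp
  qed
  moreover have "R \<subseteq> S \<times> T"
    by (auto simp: R_def)
  ultimately show ?thesis
    by (intro exI[of _ R]) simp
qed

section \<open>Bandwidth\<close>

text \<open>The minimum is attained, since no labelling of a finite graph stretches an edge beyond its order.\<close>

lemma bandwidth_labelling:
  assumes "finite (pverts H)" "parcs H \<subseteq> pverts H \<times> pverts H"
  obtains f where "bij_betw f (pverts H) {1..order_of H}"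
    and "\<And>u v. (u, v) \<in> parcs H \<Longrightarrow> \<bar>int (f u) - int (f v)\<bar> \<le> int (bandwidth H)"
proof -
  let ?P = "\<lambda>b. 0 < b \<and> (\<exists>f. bij_betw f (pverts H) {1..order_of H} \<and>
    (\<forall>(u, v) \<in> parcs H. \<bar>int (f u) - int (f v)\<bar> \<le> int b))"
  have "\<exists>f. bij_betw f (pverts H) {1..order_of H}"
    using assms(1) by (intro finite_same_card_bij) (simp_all add: order_of_def)
  then obtain f where f: "bij_betw f (pverts H) {1..order_of H}"
    by blast
  have "\<bar>int (f u) - int (f v)\<bar> \<le> int (Suc (order_of H))" if "(u, v) \<in> parcs H" for u v
  proof -
    have "u \<in> pverts H" "v \<in> pverts H"
      using assms(2) that by auto
    then have "f u \<in> {1..order_of H}" "f v \<in> {1..order_of H}"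
      using bij_betwE[OF f] by blast+
    then show ?thesis
      by auto
  qed
  then have "?P (Suc (order_of H))"
    using f by (intro conjI exI[of _ f]) auto
  then have "?P (bandwidth H)"
    unfolding bandwidth_def by (rule LeastI)
  then obtain h where "bij_betw h (pverts H) {1..order_of H}"
    and "\<forall>(u, v) \<in> parcs H. \<bar>int (h u) - int (h v)\<bar> \<le> int (bandwidth H)"
    by blast
  then show ?thesis
    by (intro that[of h]) auto
qed

lemma bandwidth_greater_if_common_neighbours:
  assumes "finite (pverts H)" "parcs H \<subseteq> pverts H \<times> pverts H"
    and common: "\<And>A B. A \<subseteq> pverts H \<Longrightarrow> B \<subseteq> pverts H \<Longrightarrow> card A = m \<Longrightarrow> card B = m \<Longrightarrow>
      \<exists>x. \<exists>a \<in> A. \<exists>b \<in> B. (x, a) \<in> parcs H \<and> (x, b) \<in> parcs H"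
    and gap: "2 * m + 2 * b \<le> order_of H"
  shows "b < bandwidth H"
proof -
  let ?n = "order_of H"
  obtain f where f: "bij_betw f (pverts H) {1..?n}"
    and width: "\<And>u v. (u, v) \<in> parcs H \<Longrightarrow> \<bar>int (f u) - int (f v)\<bar> \<le> int (bandwidth H)"
    using bandwidth_labelling[OF assms(1,2)] by blast
  have preimage: "inv_into (pverts H) f ` L \<subseteq> pverts H \<and> card (inv_into (pverts H) f ` L) = card L \<and>
      f ` inv_into (pverts H) f ` L = L"
    if "L \<subseteq> {1..?n}" for L
  proof -
    note inv = bij_betw_inv_into[OF f]
    have "f ` inv_into (pverts H) f ` L = L"
      using f that by (intro image_inv_into_cancel) (auto simp: bij_betw_def)
    then show ?thesis
      using inv that bij_betw_subset[OF inv that] by (auto simp: bij_betw_def card_image)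
  qed
  define A where "A = inv_into (pverts H) f ` {1..m}"
  define B where "B = inv_into (pverts H) f ` {?n - m + 1..?n}"
  have A: "A \<subseteq> pverts H" "card A = m" "f ` A = {1..m}"
    using preimage[of "{1..m}"] gap by (auto simp: A_def)
  have B: "B \<subseteq> pverts H" "card B = m" "f ` B = {?n - m + 1..?n}"
    using preimage[of "{?n - m + 1..?n}"] gap by (auto simp: B_def)
  obtain x a b' where "a \<in> A" "b' \<in> B" "(x, a) \<in> parcs H" "(x, b') \<in> parcs H"
    using common[OF A(1) B(1) A(2) B(2)] by blast
  moreover have "f a \<le> m" "?n - m + 1 \<le> f b'"
    using A(3) B(3) \<open>a \<in> A\<close> \<open>b' \<in> B\<close> by auto
  ultimately show ?thesis
    using width[of x a] width[of x b'] gap by linarith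
qed

section \<open>Bipartite graphs\<close>

definition bipartite_graph :: "'a set \<Rightarrow> 'a set \<Rightarrow> 'a rel \<Rightarrow> 'a pair_pre_digraph" where
  "bipartite_graph S T R = \<lparr>pverts = S \<union> T, parcs = R \<union> R\<inverse>\<rparr>"

lemma bipartite_graph_simps [simp]:
  "pverts (bipartite_graph S T R) = S \<union> T"
  "parcs (bipartite_graph S T R) = R \<union> R\<inverse>"
  by (simp_all add: bipartite_graph_def)

lemma pair_graph_bipartite_graph:
  assumes "finite S" "finite T" "S \<inter> T = {}" "R \<subseteq> S \<times> T"
  shows "pair_graph (bipartite_graph S T R)"
proof -
  have "finite R"
    using assms by (auto intro: finite_subset)
  then show ?thesis
    using assms by unfold_locales (auto simp: symmetric_def sym_def)
qed

lemma max_degree_bipartite_graph_le: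
  assumes "finite S" "finite T" "S \<inter> T = {}" "R \<subseteq> S \<times> T"
    and "\<And>x. card {y. (x, y) \<in> R} \<le> D" "\<And>y. card {x. (x, y) \<in> R} \<le> D"
  shows "max_degree (bipartite_graph S T R) \<le> D"
proof -
  have "out_degree (with_proj (bipartite_graph S T R)) v \<le> D" if "v \<in> S \<union> T" for v
  proof -
    have arcs: "out_arcs (with_proj (bipartite_graph S T R)) v =
        Pair v ` (if v \<in> S then {y. (v, y) \<in> R} else {x. (x, v) \<in> R})"
      using assms(3,4) that by (auto simp: out_arcs_def)
    show ?thesis
      unfolding out_degree_def arcs using assms(5,6)[of v]
      by (subst card_image) (auto simp: inj_on_def)
  qed
  then show ?thesis
    using assms(1,2) by (simp add: max_degree_def)
qed

text \<open>Removing one side destroys all edges, so the components of the rest are single vertices.\<close>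

lemma separable_bipartite_graph:
  assumes "R \<subseteq> S \<times> T"
    and "real (card S) \<le> \<gamma> * real (order_of (bipartite_graph S T R))"
    and "1 \<le> \<gamma> * real (order_of (bipartite_graph S T R))"
  shows "separable \<gamma> (bipartite_graph S T R)"
proof -
  let ?H = "bipartite_graph S T R"
  let ?G = "induce_subgraph (with_proj ?H) (pverts ?H - S)"
  have "arcs_ends ?G = {}"
    using assms(1) by (auto simp: arcs_ends_def)
  then have reachable_eq: "u = v" if "u \<rightarrow>\<^sup>*\<^bsub>?G\<^esub> v" for u v
    using that by (auto simp: reachable_def elim: rtrancl_on.cases)
  have card_le: "card C \<le> 1" if "C \<in> pre_digraph.sccs_verts ?G" for C
  proof -
    have "\<forall>u \<in> C. \<forall>v \<in> C. u = v"
      using that reachable_eq unfolding pre_digraph.sccs_verts_def by blast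
    then show ?thesis
      by (metis card_le_Suc0_iff_eq card.infinite One_nat_def zero_le)
  qed
  then have "real (card C) \<le> \<gamma> * real (order_of ?H)" if "C \<in> pre_digraph.sccs_verts ?G" for C
    using card_le[OF that] assms(3) by linarith
  then show ?thesis
    unfolding separable_def using assms(2) by (intro exI[of _ S]) auto
qed

lemma order_of_eq_if_digraph_iso:
  assumes "digraph_iso (with_proj H) (with_proj H')"
  shows "order_of H = order_of H'"
proof -
  obtain h where h: "pre_digraph.digraph_isomorphism (with_proj H) h"
    and "with_proj H' = app_iso h (with_proj H)"
    using assms by (auto simp: digraph_iso_def)
  then have "pverts H' = iso_verts h ` pverts H"
    by (metis verts_app_iso with_proj_simps(1))
  moreover have "inj_on (iso_verts h) (pverts H)"
    using pre_digraph.digraph_isomorphism_inj_on_verts[OF h] by simp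
  ultimately show ?thesis
    by (simp add: order_of_def card_image)
qed

section \<open>The graph class\<close>

text \<open>
  Among any \<open>3 p\<close> vertices at least \<open>2 p\<close> lie in \<open>T\<close>, because \<open>s \<le> p\<close>; this is how sets of vertices
  are reduced to the subsets of \<open>T\<close> on which the relation is known to mix.
\<close>

lemma exists_separable_graph_of_linear_bandwidth:
  assumes "0 < s" "0 < q"
  shows "\<exists>H :: nat pair_pre_digraph. pair_graph H \<and> order_of H = 8 * (s * q) \<and>
    separable (1 / (8 * real q)) H \<and> s * q < bandwidth H \<and> max_degree H \<le> 160 * q"
proof -
  define p where "p = s * q"
  define S T where "S = {..<s}" and "T = {s..<8 * p}"
  have "s \<le> p" "0 < p"
    using assms by (auto simp: p_def)
  have S: "finite S" "card S = s" "S \<noteq> {}"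
    using \<open>0 < s\<close> by (auto simp: S_def)
  have T: "finite T" "S \<inter> T = {}" "card S + card T = 8 * p"
    using \<open>s \<le> p\<close> \<open>0 < p\<close> by (auto simp: S_def T_def)
  obtain R where R: "R \<subseteq> S \<times> T"
    and deg_S: "\<And>x. card {y. (x, y) \<in> R} \<le> 160 * q" and deg_T: "\<And>y. card {x. (x, y) \<in> R} \<le> 10"
    and mixing: "\<And>A B. A \<subseteq> T \<Longrightarrow> B \<subseteq> T \<Longrightarrow> card A = 2 * p \<Longrightarrow> card B = 2 * p \<Longrightarrow>
      \<exists>x. \<exists>a \<in> A. \<exists>b \<in> B. (x, a) \<in> R \<and> (x, b) \<in> R"
    using exists_bounded_degree_mixing_relation[OF S(1) T(1) S(3) \<open>0 < p\<close> T(3), of "160 * q"] S(2)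
    by (auto simp: p_def)
  define H where "H = bipartite_graph S T R"
  have order: "order_of H = 8 * p"
    using S T by (simp add: H_def order_of_def card_Un_disjoint)
  have \<gamma>_order: "1 / (8 * real q) * real (order_of H) = real s"
    using \<open>0 < q\<close> by (simp add: order p_def)
  have "separable (1 / (8 * real q)) H"
    using R \<gamma>_order \<open>0 < s\<close> S(2) unfolding H_def by (intro separable_bipartite_graph) auto
  moreover have "max_degree H \<le> 160 * q"
    unfolding H_def
  proof (rule max_degree_bipartite_graph_le)
    show "card {x. (x, y) \<in> R} \<le> 160 * q" for y
      using deg_T[of y] \<open>0 < q\<close> by linarith
  qed (use R S T deg_S in auto)
  moreover have "p < bandwidth H"
  proof (rule bandwidth_greater_if_common_neighbours[where m = "3 * p"])
    fix A B
    assume A: "A \<subseteq> pverts H" "card A = 3 * p" and B: "B \<subseteq> pverts H" "card B = 3 * p"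
    have restrict: "\<exists>Y \<subseteq> X. Y \<subseteq> T \<and> card Y = 2 * p" if "X \<subseteq> pverts H" "card X = 3 * p" for X
    proof -
      have "X - S \<subseteq> T"
        using that by (auto simp: H_def)
      moreover have "2 * p \<le> card (X - S)"
        using diff_card_le_card_Diff[OF S(1), of X] that(2) S(2) \<open>s \<le> p\<close> by linarith
      then obtain Y where "Y \<subseteq> X - S" "card Y = 2 * p"
        by (rule obtain_subset_with_card_n)
      ultimately show ?thesis
        by (intro exI[of _ Y]) auto
    qed
    obtain A' B' where "A' \<subseteq> A" "A' \<subseteq> T" "card A' = 2 * p" "B' \<subseteq> B" "B' \<subseteq> T" "card B' = 2 * p"
      using restrict[OF A] restrict[OF B] by blast
    moreover from this obtain x a b where "a \<in> A'" "b \<in> B'" "(x, a) \<in> R" "(x, b) \<in> R"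
      using mixing[of A' B'] by blast
    moreover have "R \<subseteq> parcs H"
      by (simp add: H_def)
    ultimately show "\<exists>x. \<exists>a \<in> A. \<exists>b \<in> B. (x, a) \<in> parcs H \<and> (x, b) \<in> parcs H"
      by blast
  qed (use R S T order in \<open>auto simp: H_def\<close>)
  ultimately show ?thesis
    using pair_graph_bipartite_graph[OF S(1) T(1,2) R] order unfolding H_def p_def by blast
qed

text \<open>
  One graph for every \<open>s \<ge> 1\<close> gives infinitely many orders \<open>8 s q\<close>, hence pairwise non-isomorphic
  graphs. Since \<open>0.3 / (2 t + 4) \<le> 1 / 8\<close>, bandwidth above \<open>s q\<close> is more than enough.
\<close>

theorem theorem2:
  shows "\<exists>K::real. K > 0 \<and>
    (\<forall>r t :: nat. r \<ge> 35 \<longrightarrow> t \<ge> 1 \<longrightarrow>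
      (let \<gamma> = 1 / (8 * real r * 2 ^ r) in
        \<exists>\<H> :: nat pair_pre_digraph set. infinite_graph_class \<H> \<and>
          (\<forall>H \<in> \<H>.
             separable \<gamma> H \<and>
             real (bandwidth H) \<ge> 0.3 * real (order_of H) / (2 * real t + 4) \<and>
             real (max_degree H) \<le> K * (1 / \<gamma>))))"
proof (intro exI[of _ "20::real"] conjI allI impI)
  fix r t :: nat
  assume "r \<ge> 35" "t \<ge> 1"
  define q where "q = r * 2 ^ r"
  define \<gamma> where "\<gamma> = 1 / (8 * real r * 2 ^ r)"
  have "0 < q" and \<gamma>: "\<gamma> = 1 / (8 * real q)"
    using \<open>r \<ge> 35\<close> by (auto simp: q_def \<gamma>_def)
  have "\<forall>s. \<exists>H :: nat pair_pre_digraph. 0 < s \<longrightarrow> pair_graph H \<and> order_of H = 8 * (s * q) \<and>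
      separable \<gamma> H \<and> s * q < bandwidth H \<and> max_degree H \<le> 160 * q"
    using exists_separable_graph_of_linear_bandwidth[OF _ \<open>0 < q\<close>] unfolding \<gamma> by blast
  then obtain G :: "nat \<Rightarrow> nat pair_pre_digraph" where G: "\<And>s. 0 < s \<Longrightarrow> pair_graph (G s)"
      "\<And>s. 0 < s \<Longrightarrow> order_of (G s) = 8 * (s * q)" "\<And>s. 0 < s \<Longrightarrow> separable \<gamma> (G s)"
      "\<And>s. 0 < s \<Longrightarrow> s * q < bandwidth (G s)" "\<And>s. 0 < s \<Longrightarrow> max_degree (G s) \<le> 160 * q"
    by metis
  have order_inj: "s = s'" if "0 < s" "0 < s'" "order_of (G s) = order_of (G s')" for s s'
    using that G(2) \<open>0 < q\<close> by simp
  have "infinite (G ` {0<..})"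
  proof
    assume "finite (G ` {0<..})"
    moreover have "inj_on G {0<..}"
      using order_inj by (auto simp: inj_on_def)
    ultimately show False
      using finite_imageD infinite_Ioi[of "0::nat"] by blast
  qed
  then have "infinite_graph_class (G ` {0<..})"
    using G(1) order_inj[OF _ _ order_of_eq_if_digraph_iso]
    by (auto simp: infinite_graph_class_def)
  moreover have "real (bandwidth (G s)) \<ge> 0.3 * real (order_of (G s)) / (2 * real t + 4)"
    if "0 < s" for s
  proof -
    have "0.3 * real (order_of (G s)) / (2 * real t + 4) \<le> 0.3 * real (order_of (G s)) / 4"
      by (intro divide_left_mono) auto
    also have "\<dots> \<le> real (s * q)"
      using G(2)[OF that] by simp
    finally show ?thesis
      using G(4)[OF that] by linarith
  qed
  moreover have "real (max_degree (G s)) \<le> 20 * (1 / \<gamma>)" if "0 < s" for s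
    using G(5)[OF that] by (simp add: \<gamma>)
  ultimately show "let \<gamma> = 1 / (8 * real r * 2 ^ r) in
      \<exists>\<H> :: nat pair_pre_digraph set. infinite_graph_class \<H> \<and>
        (\<forall>H \<in> \<H>. separable \<gamma> H \<and>
           real (bandwidth H) \<ge> 0.3 * real (order_of H) / (2 * real t + 4) \<and>
           real (max_degree H) \<le> 20 * (1 / \<gamma>))"
    unfolding Let_def \<gamma>_def[symmetric] using G(3)
    by (intro exI[of _ "G ` {0<..}"]) auto
qed simp

end
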